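(* Let $k\ge 2$ and let $\varphi_k:(\mathbb{K}^{2k-2},0)\to(\mathbb{K}^{2k-1},0)$ be the minimal cross cap mapping of multiplicity $k$. For each $j$ with $1\le j\le k-1$, the vector field $\xi^1_j$ on $(\mathbb{K}^{2k-1},0)$ whose components are \[ \xi^1_j=(A^1_{1,j},\dots,A^1_{k-2,j},B^1_{1,j},\dots,B^1_{k-1,j},C^1_{1,j},C^1_{2,j})^T \] with \begin{align*} A_{i,j}^1&=(k-i)(k-j)U_iU_j, && 1\le i\le k-2,\\ B_{i,j}^1&=k\sum_{r=1}^{i-1}U_{i+j-r}V_r-k\sum_{r=1}^iU_rV_{i+j-r}-(i-1)(k-j)U_jV_i+kV_{i+j}W_1-kU_{i+j}W_2, && 1\le i\le k-1,\\ C_{1,j}^1&=k(k-j)U_jW_1,\\ C_{2,j}^1&=-kV_jW_1+(k-j)U_jW_2 \end{align*} is liftable over $\varphi_k$.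
   Context: $\mathbb{K}=\mathbb{R}$ or $\mathbb{C}$; maps, functions and vector fields are germs that are smooth (infinitely differentiable) or $\mathbb{K}$-analytic. The minimal cross cap mapping of multiplicity $k\ge2$ is $\varphi_k:(\mathbb{K}^{2k-2},0)\to(\mathbb{K}^{2k-1},0)$, \[ \varphi_k(u_1,\ldots,u_{k-2},v_1,\ldots,v_{k-1},y)=\Big(u_1,\ldots,u_{k-2},v_1,\ldots,v_{k-1},\,y^k+\sum_{i=1}^{k-2}u_iy^i,\ \sum_{i=1}^{k-1}v_iy^i\Big). \] The coordinates on the target are, in order, $U_1,\dots,U_{k-2},V_1,\dots,V_{k-1},W_1,W_2$; components of vector fields are listed in this order. Dummy variable convention: $U_{k-1}=V_k=0$, $U_k=1$, and $U_r=V_r=0$ for $r\le 0$ and for $r>k$. Empty sums are $0$. A vector field germ $\xi$ on $(\mathbb{K}^p,0)$ is liftable over $f:(\mathbb{K}^n,0)\to(\mathbb{K}^p,0)$ if there is a vector field germ $\eta$ on $(\mathbb{K}^n,0)$ with $df\circ\eta=\xi\circ f$, i.e. (writing vector fields as column vectors of functions and $J_f$ for the Jacobian matrix) $J_f\,\eta=\xi\circ f$. *)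

theory Defs
  imports "HOL-Analysis.Analysis"
begin

section \<open>Germs on \<open>K^n\<close>\<close>

text \<open>
  A point of \<open>K^n\<close> is a family of coordinates indexed by \<open>1, \<dots>, n\<close>, extended by \<open>0\<close>. The
  product topology on functions induces the Euclidean topology on \<open>kspace n\<close>. At type
  \<^typ>\<open>nat \<Rightarrow> nat\<close>, \<open>kspace n\<close> is the set of multi-indices in \<open>n\<close> variables.
\<close>

definition kspace :: "nat \<Rightarrow> (nat \<Rightarrow> 'a::zero) set" where
  "kspace n = {x. \<forall>i. i \<notin> {1..n} \<longrightarrow> x i = 0}"

definition near_origin :: "nat \<Rightarrow> (nat \<Rightarrow> 'a::{zero,topological_space}) filter" where
  "near_origin n = inf (nhds (\<lambda>_. 0)) (principal (kspace n))"

text \<open>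
  Germs are represented by total functions of which only the values on a neighbourhood of
  the origin in \<open>kspace n\<close> matter. All derivatives are taken over the scalar field
  \<^typ>\<open>'a\<close>, so they are complex derivatives when the scalars are complex.
\<close>

definition partial_deriv ::
    "nat \<Rightarrow> ((nat \<Rightarrow> 'a::real_normed_field) \<Rightarrow> 'a) \<Rightarrow> (nat \<Rightarrow> 'a) \<Rightarrow> 'a" where
  "partial_deriv i f x = deriv (\<lambda>t. f (x(i := t))) (x i)"

primrec times_cont_diff_on ::
    "nat \<Rightarrow> nat \<Rightarrow> (nat \<Rightarrow> 'a::real_normed_field) set \<Rightarrow> ((nat \<Rightarrow> 'a) \<Rightarrow> 'a) \<Rightarrow> bool" where
  "times_cont_diff_on 0 n S f \<longleftrightarrow> continuous_on S f"
| "times_cont_diff_on (Suc m) n S f \<longleftrightarrow> continuous_on S f \<and>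
     (\<forall>i\<in>{1..n}. (\<forall>x\<in>S. (\<lambda>t. f (x(i := t))) field_differentiable (at (x i))) \<and>
                times_cont_diff_on m n S (partial_deriv i f))"

definition smooth_germ :: "nat \<Rightarrow> ((nat \<Rightarrow> 'a::real_normed_field) \<Rightarrow> 'a) \<Rightarrow> bool" where
  "smooth_germ n f \<longleftrightarrow>
     (\<exists>S. open S \<and> (\<lambda>_. 0) \<in> S \<and> (\<forall>m. times_cont_diff_on m n (S \<inter> kspace n) f))"

definition analytic_germ :: "nat \<Rightarrow> ((nat \<Rightarrow> 'a::real_normed_field) \<Rightarrow> 'a) \<Rightarrow> bool" where
  "analytic_germ n f \<longleftrightarrow>
     (\<exists>c. \<forall>\<^sub>F x in near_origin n.
        ((\<lambda>\<alpha>. c \<alpha> * (\<Prod>i=1..n. x i ^ \<alpha> i)) has_sum f x) (kspace n))"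

datatype regularity = Smooth | Analytic

primrec function_germ ::
    "regularity \<Rightarrow> nat \<Rightarrow> ((nat \<Rightarrow> 'a::real_normed_field) \<Rightarrow> 'a) \<Rightarrow> bool" where
  "function_germ Smooth = smooth_germ"
| "function_germ Analytic = analytic_germ"

definition map_germ ::
    "regularity \<Rightarrow> nat \<Rightarrow> nat \<Rightarrow> ((nat \<Rightarrow> 'a::real_normed_field) \<Rightarrow> (nat \<Rightarrow> 'a)) \<Rightarrow> bool" where
  "map_germ c n p f \<longleftrightarrow>
     (\<forall>\<^sub>F x in near_origin n. f x \<in> kspace p) \<and> f (\<lambda>_. 0) = (\<lambda>_. 0) \<and>
     (\<forall>i\<in>{1..p}. function_germ c n (\<lambda>x. f x i))"

text \<open>Unlike a map germ, a vector field germ need not vanish at the origin.\<close>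

definition vector_field_germ ::
    "regularity \<Rightarrow> nat \<Rightarrow> ((nat \<Rightarrow> 'a::real_normed_field) \<Rightarrow> (nat \<Rightarrow> 'a)) \<Rightarrow> bool" where
  "vector_field_germ c n \<eta> \<longleftrightarrow>
     (\<forall>\<^sub>F x in near_origin n. \<eta> x \<in> kspace n) \<and>
     (\<forall>i\<in>{1..n}. function_germ c n (\<lambda>x. \<eta> x i))"

definition jacobian_matrix ::
    "((nat \<Rightarrow> 'a::real_normed_field) \<Rightarrow> (nat \<Rightarrow> 'a)) \<Rightarrow> (nat \<Rightarrow> 'a) \<Rightarrow> nat \<Rightarrow> nat \<Rightarrow> 'a" where
  "jacobian_matrix f x i l = partial_deriv l (\<lambda>z. f z i) x"

definition liftable ::
    "regularity \<Rightarrow> nat \<Rightarrow> nat \<Rightarrow> ((nat \<Rightarrow> 'a::real_normed_field) \<Rightarrow> (nat \<Rightarrow> 'a)) \<Rightarrow>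
     ((nat \<Rightarrow> 'a) \<Rightarrow> (nat \<Rightarrow> 'a)) \<Rightarrow> bool" where
  "liftable c n p f \<xi> \<longleftrightarrow>
     map_germ c n p f \<and> vector_field_germ c p \<xi> \<and>
     (\<exists>\<eta>. vector_field_germ c n \<eta> \<and>
        (\<forall>\<^sub>F x in near_origin n. \<forall>i\<in>{1..p}.
           (\<Sum>l=1..n. jacobian_matrix f x i l * \<eta> x l) = \<xi> (f x) i))"


section \<open>The minimal cross cap mapping\<close>

text \<open>
  The source coordinates \<open>u\<^sub>1, \<dots>, u\<^bsub>k-2\<^esub>, v\<^sub>1, \<dots>, v\<^bsub>k-1\<^esub>, y\<close> and the target coordinates
  \<open>U\<^sub>1, \<dots>, U\<^bsub>k-2\<^esub>, V\<^sub>1, \<dots>, V\<^bsub>k-1\<^esub>, W\<^sub>1, W\<^sub>2\<close> occupy the positions \<open>1, \<dots>, 2 k - 2\<close> and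
  \<open>1, \<dots>, 2 k - 1\<close>, in this order.
\<close>

definition target_vector ::
    "nat \<Rightarrow> (nat \<Rightarrow> 'a) \<Rightarrow> (nat \<Rightarrow> 'a) \<Rightarrow> 'a \<Rightarrow> 'a \<Rightarrow> (nat \<Rightarrow> 'a::zero)" where
  "target_vector k A B C\<^sub>1 C\<^sub>2 = (\<lambda>m.
     if m \<in> {1..k - 2} then A m
     else if m \<in> {k - 1..2 * k - 3} then B (m - (k - 2))
     else if m = 2 * k - 2 then C\<^sub>1
     else if m = 2 * k - 1 then C\<^sub>2
     else 0)"

definition cross_cap :: "nat \<Rightarrow> (nat \<Rightarrow> 'a::real_normed_field) \<Rightarrow> (nat \<Rightarrow> 'a)" where
  "cross_cap k x =
     (let u = (\<lambda>i. x i); v = (\<lambda>i. x (k - 2 + i)); y = x (2 * k - 2)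
      in target_vector k u v
           (y ^ k + (\<Sum>i=1..k - 2. u i * y ^ i))
           (\<Sum>i=1..k - 1. v i * y ^ i))"

text \<open>
  The coordinates \<open>U\<^sub>r\<close> and \<open>V\<^sub>r\<close> with the dummy variable convention
  \<open>U\<^bsub>k-1\<^esub> = V\<^sub>k = 0\<close>, \<open>U\<^sub>k = 1\<close> and \<open>U\<^sub>r = V\<^sub>r = 0\<close> for \<open>r \<le> 0\<close> and \<open>r > k\<close>.
  Natural number indices suffice: all index differences occurring below are positive.
\<close>

definition coord_U :: "nat \<Rightarrow> (nat \<Rightarrow> 'a::real_normed_field) \<Rightarrow> nat \<Rightarrow> 'a" where
  "coord_U k X r = (if r \<in> {1..k - 2} then X r else if r = k then 1 else 0)"

definition coord_V :: "nat \<Rightarrow> (nat \<Rightarrow> 'a::real_normed_field) \<Rightarrow> nat \<Rightarrow> 'a" where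
  "coord_V k X r = (if r \<in> {1..k - 1} then X (k - 2 + r) else 0)"

definition xi1 ::
    "nat \<Rightarrow> nat \<Rightarrow> (nat \<Rightarrow> 'a::real_normed_field) \<Rightarrow> (nat \<Rightarrow> 'a)" where
  "xi1 k j X =
     (let U = coord_U k X; V = coord_V k X; W\<^sub>1 = X (2 * k - 2); W\<^sub>2 = X (2 * k - 1)
      in target_vector k
           (\<lambda>i. of_nat (k - i) * of_nat (k - j) * U i * U j)
           (\<lambda>i. of_nat k * (\<Sum>r=1..<i. U (i + j - r) * V r)
                - of_nat k * (\<Sum>r=1..i. U r * V (i + j - r))
                - of_nat (i - 1) * of_nat (k - j) * U j * V i
                + of_nat k * V (i + j) * W\<^sub>1
                - of_nat k * U (i + j) * W\<^sub>2)
           (of_nat k * of_nat (k - j) * U j * W\<^sub>1)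
           (- of_nat k * V j * W\<^sub>1 + of_nat (k - j) * U j * W\<^sub>2))"

end

theory Submission
  imports Defs
begin

text \<open>
  Lift \<open>\<xi>\<^sup>1\<^sub>j\<close> by keeping its first \<open>2 k - 3\<close> components (composed with the cross cap) and taking
  \<open>(k - j) u\<^sub>j y\<close> as the component in the direction of \<open>y\<close>. Write \<open>W\<^sub>1 = \<Sum>\<^sub>r U\<^sub>r y\<^sup>r\<close> and
  \<open>W\<^sub>2 = \<Sum>\<^sub>s V\<^sub>s y\<^sup>s\<close>. The row of \<open>W\<^sub>1\<close> is Euler's identity
  \<open>k W\<^sub>1 - y W\<^sub>1' = \<Sum>\<^sub>r (k - r) U\<^sub>r y\<^sup>r\<close>. In the row of \<open>W\<^sub>2\<close>, Euler's identity removes the terms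
  containing \<open>k - j\<close>, and the others cancel as sums of the monomials \<open>U\<^sub>r V\<^sub>s y\<^bsup>r+s-j\<^esup>\<close>.
  All functions involved are polynomials, so they are smooth and analytic over both fields.
\<close>

section \<open>Polynomial functions are smooth and analytic\<close>

text \<open>Closure under ring operations gives an induction principle for both regularity classes.
  Only the positions \<open>1, ..., n\<close> occur as variables, so these functions have expansions
  in \<open>n\<close> variables at every point, also outside \<open>kspace n\<close>.\<close>

inductive polynomial_map :: "nat \<Rightarrow> ((nat \<Rightarrow> 'a::real_normed_field) \<Rightarrow> 'a) \<Rightarrow> bool"
  for n :: nat where
  const: "polynomial_map n (\<lambda>x. a)"
| coord: "i \<in> {1..n} \<Longrightarrow> polynomial_map n (\<lambda>x. x i)"
| add: "polynomial_map n f \<Longrightarrow> polynomial_map n g \<Longrightarrow> polynomial_map n (\<lambda>x. f x + g x)"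
| mult: "polynomial_map n f \<Longrightarrow> polynomial_map n g \<Longrightarrow> polynomial_map n (\<lambda>x. f x * g x)"

text \<open>The condition is independent of the point: it serves the case distinctions on positions
  in \<open>target_vector\<close>, \<open>coord_U\<close> and \<open>coord_V\<close>.\<close>

lemma polynomial_map_if:
  assumes "P \<Longrightarrow> polynomial_map n f" "\<not> P \<Longrightarrow> polynomial_map n g"
  shows "polynomial_map n (\<lambda>x. if P then f x else g x)"
  using assms by (cases P) simp_all

lemma polynomial_map_minus:
  assumes "polynomial_map n f"
  shows "polynomial_map n (\<lambda>x. - f x)"
  using polynomial_map.mult[OF polynomial_map.const[of n "-1"] assms] by simp

lemma polynomial_map_diff:
  assumes "polynomial_map n f" "polynomial_map n g"
  shows "polynomial_map n (\<lambda>x. f x - g x)"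
  using polynomial_map.add[OF assms(1) polynomial_map_minus[OF assms(2)]] by simp

lemma polynomial_map_power:
  assumes "polynomial_map n f"
  shows "polynomial_map n (\<lambda>x. f x ^ m)"
  by (induction m) (auto intro: polynomial_map.intros assms)

lemma polynomial_map_sum:
  assumes "\<And>i. i \<in> I \<Longrightarrow> polynomial_map n (f i)"
  shows "polynomial_map n (\<lambda>x. \<Sum>i\<in>I. f i x)"
  using assms
  by (induction I rule: infinite_finite_induct) (auto intro: polynomial_map.intros)

lemmas polynomial_map_intros =
  polynomial_map.intros polynomial_map_minus polynomial_map_diff polynomial_map_power
  polynomial_map_sum polynomial_map_if

lemma polynomial_map_compose:
  assumes "polynomial_map p f" "\<And>i. i \<in> {1..p} \<Longrightarrow> polynomial_map n (\<lambda>x. g x i)"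
  shows "polynomial_map n (\<lambda>x. f (g x))"
  using assms by induction (auto intro: polynomial_map_intros)

section \<open>Continuity and iterated partial derivatives of polynomial functions\<close>

lemma polynomial_map_continuous_on:
  "polynomial_map n f \<Longrightarrow> continuous_on S f"
proof (induction rule: polynomial_map.induct)
  case (coord i)
  show ?case
    by (rule continuous_on_subset[OF continuous_on_product_coordinates]) simp
qed (auto intro: continuous_on_const continuous_on_add continuous_on_mult)

text \<open>The derivative is again polynomial, so differentiation can be iterated. The form with
  \<open>has_field_derivative\<close> yields both differentiability and the value of
  \<open>partial_deriv\<close>.\<close>

lemma polynomial_map_partial_deriv:
  assumes "polynomial_map n f"
  obtains g where "polynomial_map n g"
    and "\<And>x. ((\<lambda>t. f (x(i := t))) has_field_derivative g x) (at (x i))"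
proof -
  have "\<exists>g. polynomial_map n g \<and>
      (\<forall>x. ((\<lambda>t. f (x(i := t))) has_field_derivative g x) (at (x i)))"
    using assms
  proof induction
    case (const a)
    show ?case by (intro exI[of _ "\<lambda>x. 0"]) (simp add: polynomial_map.const)
  next
    case (coord l)
    show ?case
      by (intro exI[of _ "\<lambda>x. if l = i then 1 else 0"]) (simp add: polynomial_map.const)
  next
    case (add f g)
    obtain f' g' where *: "polynomial_map n f'" "polynomial_map n g'"
      and **: "\<And>x. ((\<lambda>t. f (x(i := t))) has_field_derivative f' x) (at (x i))"
        "\<And>x. ((\<lambda>t. g (x(i := t))) has_field_derivative g' x) (at (x i))"
      using add.IH by blast
    have "((\<lambda>t. f (x(i := t)) + g (x(i := t))) has_field_derivative f' x + g' x) (at (x i))" for x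
      by (rule DERIV_add[OF **])
    then show ?case
      by (intro exI[of _ "\<lambda>x. f' x + g' x"] conjI allI polynomial_map.add *)
  next
    case (mult f g)
    obtain f' g' where *: "polynomial_map n f'" "polynomial_map n g'"
      and **: "\<And>x. ((\<lambda>t. f (x(i := t))) has_field_derivative f' x) (at (x i))"
        "\<And>x. ((\<lambda>t. g (x(i := t))) has_field_derivative g' x) (at (x i))"
      using mult.IH by blast
    have "((\<lambda>t. f (x(i := t)) * g (x(i := t))) has_field_derivative
        f' x * g x + g' x * f x) (at (x i))" for x
      \<comment> \<open>At the base point the update is trivial, \<open>x(i := x i) = x\<close>, so
        the undifferentiated factors become \<open>f x\<close> and \<open>g x\<close>.\<close>
      using DERIV_mult[OF **(1)[of x] **(2)[of x]] by simp
    then show ?case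
      by (intro exI[of _ "\<lambda>x. f' x * g x + g' x * f x"] conjI allI
          polynomial_map.add polynomial_map.mult mult.hyps *)
  qed
  then show ?thesis using that by blast
qed

lemma polynomial_map_times_cont_diff_on:
  "polynomial_map n f \<Longrightarrow> times_cont_diff_on m n S f"
proof (induction m arbitrary: f)
  case 0
  then show ?case by (simp add: polynomial_map_continuous_on)
next
  case (Suc m)
  have "(\<lambda>t. f (x(i := t))) field_differentiable (at (x i))"
    "times_cont_diff_on m n S (partial_deriv i f)" for i x
  proof -
    obtain g where g: "polynomial_map n g"
      "\<And>x. ((\<lambda>t. f (x(i := t))) has_field_derivative g x) (at (x i))"
      using polynomial_map_partial_deriv[OF Suc.prems, of i] by blast
    \<comment> \<open>Equality holds as functions on the whole space, so the induction hypothesis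
      for \<open>g\<close> transfers by rewriting.\<close>
    then have "partial_deriv i f = g"
      by (auto simp: partial_deriv_def fun_eq_iff intro!: DERIV_imp_deriv)
    then show "times_cont_diff_on m n S (partial_deriv i f)"
      using Suc.IH g(1) by simp
    show "(\<lambda>t. f (x(i := t))) field_differentiable (at (x i))"
      using g(2) by (auto simp: field_differentiable_def)
  qed
  then show ?case
    using Suc.prems by (auto simp: polynomial_map_continuous_on)
qed

section \<open>Everywhere convergent power series expansions\<close>

definition entire_power_series ::
    "nat \<Rightarrow> ((nat \<Rightarrow> 'a::real_normed_field) \<Rightarrow> 'a) \<Rightarrow> bool" where
  "entire_power_series n f \<longleftrightarrow>
     (\<exists>c. \<forall>x. ((\<lambda>\<alpha>. c \<alpha> * (\<Prod>i=1..n. x i ^ \<alpha> i)) has_sum f x) (kspace n))"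

lemma entire_power_series_const: "entire_power_series n (\<lambda>x. a)"
proof -
  have "((\<lambda>\<alpha>. (if \<alpha> = (\<lambda>_. 0) then a else 0) * (\<Prod>i=1..n. x i ^ \<alpha> i)) has_sum a) (kspace n)"
    for x :: "nat \<Rightarrow> 'a"
    by (rule has_sum_finite_neutralI[where B = "{\<lambda>_. 0}"]) (auto simp: kspace_def)
  then show ?thesis
    unfolding entire_power_series_def by (intro exI[of _ "\<lambda>\<alpha>. if \<alpha> = (\<lambda>_. 0) then a else 0"]) auto
qed

text \<open>Expansions hold at every point, so coefficients add without any intersection of
  neighbourhoods of convergence.\<close>

lemma entire_power_series_add:
  assumes "entire_power_series n f" "entire_power_series n g"
  shows "entire_power_series n (\<lambda>x. f x + g x)"
proof -
  obtain c d where
    c: "\<And>x. ((\<lambda>\<alpha>. c \<alpha> * (\<Prod>i=1..n. x i ^ \<alpha> i)) has_sum f x) (kspace n)"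
    and d: "\<And>x. ((\<lambda>\<alpha>. d \<alpha> * (\<Prod>i=1..n. x i ^ \<alpha> i)) has_sum g x) (kspace n)"
    using assms unfolding entire_power_series_def by blast
  show ?thesis
    unfolding entire_power_series_def
    using has_sum_add[OF c d]
    by (intro exI[of _ "\<lambda>\<alpha>. c \<alpha> + d \<alpha>"]) (simp add: distrib_right)
qed

lemma entire_power_series_cmult:
  assumes "entire_power_series n f"
  shows "entire_power_series n (\<lambda>x. a * f x)"
proof -
  obtain c where "\<And>x. ((\<lambda>\<alpha>. c \<alpha> * (\<Prod>i=1..n. x i ^ \<alpha> i)) has_sum f x) (kspace n)"
    using assms unfolding entire_power_series_def by blast
  then show ?thesis
    unfolding entire_power_series_def
    by (intro exI[of _ "\<lambda>\<alpha>. a * c \<alpha>"]) (simp add: has_sum_cmult_right mult.assoc)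
qed

text \<open>Multiplication by \<open>x i\<close> raises the exponent at \<open>i\<close> by one, so
  the new series is the old one reindexed along an injective shift.\<close>

lemma entire_power_series_coord_mult:
  assumes "entire_power_series n f" and i: "i \<in> {1..n}"
  shows "entire_power_series n (\<lambda>x. x i * f x)"
proof -
  obtain c where c: "\<And>x. ((\<lambda>\<alpha>. c \<alpha> * (\<Prod>i=1..n. x i ^ \<alpha> i)) has_sum f x) (kspace n)"
    using assms unfolding entire_power_series_def by blast
  define up where "up \<alpha> = \<alpha>(i := Suc (\<alpha> i))" for \<alpha> :: "nat \<Rightarrow> nat"
  \<comment> \<open>The coefficients of the product: zero at monomials not divisible by
    \<open>x i\<close>, and otherwise the coefficient of the quotient by \<open>x i\<close>.\<close>
  define d where "d \<alpha> = (if \<alpha> i = 0 then 0 else c (\<alpha>(i := \<alpha> i - 1)))" for \<alpha>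
  have d_up: "d (up \<alpha>) = c \<alpha>" for \<alpha>
    by (simp add: d_def up_def)
  have prod_up: "(\<Prod>l=1..n. x l ^ up \<alpha> l) = x i * (\<Prod>l=1..n. x l ^ \<alpha> l)"
    for x :: "nat \<Rightarrow> 'a" and \<alpha>
  proof -
    have remove: "prod f {1..n} = f i * prod f ({1..n} - {i})" for f :: "nat \<Rightarrow> 'a"
      using i by (intro prod.remove) auto
    have "(\<Prod>l\<in>{1..n} - {i}. x l ^ up \<alpha> l) = (\<Prod>l\<in>{1..n} - {i}. x l ^ \<alpha> l)"
      by (rule prod.cong) (auto simp: up_def)
    then show ?thesis
      unfolding remove by (simp add: up_def mult.assoc)
  qed
  have inj: "inj_on up (kspace n)"
  proof (rule inj_onI)
    fix \<alpha> \<beta> assume "up \<alpha> = up \<beta>"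
    then have "up \<alpha> l = up \<beta> l" for l by simp
    then show "\<alpha> = \<beta>" by (auto simp: up_def fun_eq_iff split: if_splits) (metis nat.inject)
  qed
  have sub: "up ` kspace n \<subseteq> kspace n"
    using i by (auto simp: up_def kspace_def)
  have zero: "d \<alpha> = 0" if "\<alpha> \<in> kspace n" "\<alpha> \<notin> up ` kspace n" for \<alpha>
  proof (rule ccontr)
    assume "d \<alpha> \<noteq> 0"
    then have "\<alpha> = up (\<alpha>(i := \<alpha> i - 1))"
      by (auto simp: d_def up_def split: if_splits)
    moreover have "\<alpha>(i := \<alpha> i - 1) \<in> kspace n"
      using that(1) i by (auto simp: kspace_def)
    ultimately show False using that(2) by blast
  qed
  have "((\<lambda>\<alpha>. d \<alpha> * (\<Prod>l=1..n. x l ^ \<alpha> l)) has_sum x i * f x) (kspace n)" for x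
  proof -
    have "((\<lambda>\<alpha>. d (up \<alpha>) * (\<Prod>l=1..n. x l ^ up \<alpha> l)) has_sum x i * f x) (kspace n)"
      using has_sum_cmult_right[OF c[of x], of "x i"]
      by (simp only: d_up prod_up mult.left_commute[of "x i"])
    then have "((\<lambda>\<alpha>. d \<alpha> * (\<Prod>l=1..n. x l ^ \<alpha> l)) has_sum x i * f x) (up ` kspace n)"
      by (simp add: has_sum_reindex[OF inj] o_def)
    \<comment> \<open>Multi-indices outside the image of \<open>up\<close> have coefficient zero, so
      the sum extends from the image to all of \<open>kspace n\<close>.\<close>
    then show ?thesis
      using sub zero by (subst has_sum_cong_neutral[where T = "up ` kspace n"]) auto
  qed
  then show ?thesis unfolding entire_power_series_def by blast
qed

text \<open>
  Multiplying by an arbitrary power series in the induction avoids the Cauchy product.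
\<close>

lemma entire_power_series_polynomial_mult:
  assumes "polynomial_map n f" "entire_power_series n h"
  shows "entire_power_series n (\<lambda>x. f x * h x)"
  using assms
proof (induction arbitrary: h)
  case (add f g)
  then show ?case by (simp add: distrib_right entire_power_series_add)
next
  case (mult f g)
  then show ?case by (simp add: mult.assoc)
qed (simp_all add: entire_power_series_cmult entire_power_series_coord_mult)

lemma polynomial_map_function_germ:
  assumes "polynomial_map n f"
  shows "function_germ c n f"
proof (cases c)
  case Smooth
  then show ?thesis
    using polynomial_map_times_cont_diff_on[OF assms]
    by (auto simp: smooth_germ_def intro!: exI[of _ UNIV])
next
  case Analytic
  have "entire_power_series n f"
    \<comment> \<open>The function is expanded as its product with the constant series 1.\<close>
    using entire_power_series_polynomial_mult[OF assms entire_power_series_const[of n 1]] by simp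
  then show ?thesis
    unfolding Analytic function_germ.simps analytic_germ_def entire_power_series_def
    by (blast intro: always_eventually)
qed


section \<open>The cross cap and its Jacobian matrix\<close>

lemma polynomial_map_target_vector:
  assumes "\<And>i. polynomial_map n (\<lambda>x. A x i)" "\<And>i. polynomial_map n (\<lambda>x. B x i)"
    and "polynomial_map n C" "polynomial_map n D"
  shows "polynomial_map n (\<lambda>x. target_vector k (A x) (B x) (C x) (D x) m)"
  unfolding target_vector_def using assms by (intro polynomial_map_intros)

lemma target_vector_in_kspace:
  "k \<ge> 2 \<Longrightarrow> target_vector k A B C D \<in> kspace (2 * k - 1)"
  by (auto simp: target_vector_def kspace_def)

lemma target_vector_simps:
  assumes "k \<ge> 2"
  shows "i \<in> {1..k - 2} \<Longrightarrow> target_vector k A B C D i = A i"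
    and "i \<in> {1..k - 1} \<Longrightarrow> target_vector k A B C D (k - 2 + i) = B i"
    and "target_vector k A B C D (2 * k - 2) = C"
    and "target_vector k A B C D (2 * k - 1) = D"
proof -
  \<comment> \<open>This form of \<open>k\<close> turns the truncated differences
    \<open>k - 2\<close> and \<open>k - 1\<close> into \<open>m\<close> and
    \<open>Suc m\<close>.\<close>
  obtain m where "k = Suc (Suc m)" using assms by (metis le_Suc_ex add_2_eq_Suc)
  then show "i \<in> {1..k - 2} \<Longrightarrow> target_vector k A B C D i = A i"
    and "i \<in> {1..k - 1} \<Longrightarrow> target_vector k A B C D (k - 2 + i) = B i"
    and "target_vector k A B C D (2 * k - 2) = C"
    and "target_vector k A B C D (2 * k - 1) = D"
    by (auto simp: target_vector_def)
qed

text \<open>The bound on \<open>n\<close> covers both the source dimension \<open>2 * k - 2\<close>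
  and the target dimension \<open>2 * k - 1\<close>.\<close>

lemma polynomial_map_coord_U:
  assumes "2 * k - 2 \<le> n" shows "polynomial_map n (\<lambda>X. coord_U k X r)"
  using assms unfolding coord_U_def by (intro polynomial_map_intros) auto

lemma polynomial_map_coord_V:
  assumes "k \<ge> 2" "2 * k - 2 \<le> n" shows "polynomial_map n (\<lambda>X. coord_V k X r)"
  using assms unfolding coord_V_def by (intro polynomial_map_intros) auto

lemma polynomial_map_cross_cap:
  assumes "k \<ge> 2"
  shows "polynomial_map (2 * k - 2) (\<lambda>x. cross_cap k x m)"
proof -
  \<comment> \<open>\<open>polynomial_map_target_vector\<close> asks for polynomial entries at every
    index. The guards put 0 at positions outside the source and keep the entries that
    \<open>target_vector\<close> reads.\<close>
  have eq: "cross_cap k x m = target_vector k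
      (\<lambda>i. if i \<in> {1..2 * k - 2} then x i else 0)
      (\<lambda>i. if k - 2 + i \<in> {1..2 * k - 2} then x (k - 2 + i) else 0)
      (x (2 * k - 2) ^ k + (\<Sum>i=1..k - 2. x i * x (2 * k - 2) ^ i))
      (\<Sum>i=1..k - 1. x (k - 2 + i) * x (2 * k - 2) ^ i) m" for x
    unfolding cross_cap_def Let_def target_vector_def
    by (intro if_cong refl) (use assms in auto)
  show ?thesis
    unfolding eq using assms
    by (intro polynomial_map_target_vector polynomial_map_intros) auto
qed

lemma polynomial_map_xi1:
  assumes "k \<ge> 2"
  shows "polynomial_map (2 * k - 1) (\<lambda>X. xi1 k j X m)"
  unfolding xi1_def Let_def using assms
  by (intro polynomial_map_target_vector polynomial_map_intros
      polynomial_map_coord_U polynomial_map_coord_V) auto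

text \<open>The u- and v-coordinates keep their positions from source to target, so
  \<open>coord_U\<close> and \<open>coord_V\<close> may be evaluated at the source point.\<close>

lemma coord_cross_cap:
  assumes "k \<ge> 2"
  shows "coord_U k (cross_cap k x) = coord_U k x" "coord_V k (cross_cap k x) = coord_V k x"
proof -
  have "cross_cap k x i = x i" if "i \<in> {1..k - 2}" for i
    using target_vector_simps(1)[OF assms that] by (simp add: cross_cap_def Let_def)
  then show "coord_U k (cross_cap k x) = coord_U k x"
    by (auto simp: coord_U_def fun_eq_iff)
  have "cross_cap k x (k - 2 + i) = x (k - 2 + i)" if "i \<in> {1..k - 1}" for i
    unfolding cross_cap_def Let_def by (rule target_vector_simps(2)[OF assms that])
  then show "coord_V k (cross_cap k x) = coord_V k x"
    by (auto simp: coord_V_def fun_eq_iff)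
qed

lemma sum_source_coordinates:
  fixes f :: "nat \<Rightarrow> 'a::comm_monoid_add"
  assumes "k \<ge> 2"
  shows "(\<Sum>l=1..2 * k - 2. f l) =
    (\<Sum>i=1..k - 2. f i) + (\<Sum>i=1..k - 1. f (k - 2 + i)) + f (2 * k - 2)"
proof -
  obtain m where k: "k = m + 2" using assms le_Suc_ex by (metis add.commute)
  have "(\<Sum>l=1..m + Suc m. f l) = (\<Sum>l=1..m. f l) + (\<Sum>l=m + 1..m + Suc m. f l)"
    by (rule sum.ub_add_nat) simp
  also have "(\<Sum>l=m + 1..m + Suc m. f l) = (\<Sum>i=1..Suc m. f (m + i))"
    using sum.shift_bounds_cl_nat_ivl[of f 1 m "Suc m"] by (simp add: add.commute)
  finally have "(\<Sum>l=1..m + Suc m. f l) = (\<Sum>l=1..m. f l) + (\<Sum>i=1..Suc m. f (m + i))" .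
  moreover have "2 * k - 2 = Suc (m + Suc m)" "k - 2 = m" "k - 1 = Suc m" using k by auto
  ultimately show ?thesis by simp
qed

text \<open>The dummy values \<open>U_k = 1\<close> and \<open>U_{k-1} = 0\<close> supply the top
  term and remove the next one. With general weights \<open>a\<close> this covers both the first
  cross cap polynomial and its derivative in y.\<close>

lemma sum_coord_U:
  fixes a :: "nat \<Rightarrow> 'a::real_normed_field"
  assumes "k \<ge> 2"
  shows "(\<Sum>r=1..k. coord_U k x r * a r) = a k + (\<Sum>r=1..k - 2. x r * a r)"
proof -
  obtain m where k: "k = Suc (Suc m)" using assms by (metis le_Suc_ex add_2_eq_Suc)
  show ?thesis unfolding k by (simp add: coord_U_def)
qed

section \<open>Rows of the Jacobian matrix of the cross cap\<close>

lemma jacobian_matrix_cross_cap_coordinate: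
  assumes "k \<ge> 2" "i \<in> {1..2 * k - 3}"
  shows "jacobian_matrix (cross_cap k) x i l = (if l = i then 1 else 0)"
proof -
  have "cross_cap k z i = z i" for z :: "nat \<Rightarrow> 'a"
    using assms by (auto simp: cross_cap_def Let_def target_vector_def)
  then show ?thesis
    by (auto simp: jacobian_matrix_def partial_deriv_def)
qed

lemma jacobian_matrix_cross_cap_W1:
  assumes "k \<ge> 2"
  shows "i \<in> {1..k - 2} \<Longrightarrow>
      jacobian_matrix (cross_cap k) x (2 * k - 2) i = x (2 * k - 2) ^ i"
    and "i \<in> {1..k - 1} \<Longrightarrow> jacobian_matrix (cross_cap k) x (2 * k - 2) (k - 2 + i) = 0"
    and "jacobian_matrix (cross_cap k) x (2 * k - 2) (2 * k - 2) =
      (\<Sum>r=1..k. coord_U k x r * (of_nat r * x (2 * k - 2) ^ (r - 1)))"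
proof -
  \<comment> \<open>Here \<open>y\<close> is a position, not a value: that of the last source
    coordinate and also of \<open>W1\<close> in the target.\<close>
  define y where "y = 2 * k - 2"
  have eq: "cross_cap k z y = z y ^ k + (\<Sum>r=1..k - 2. z r * z y ^ r)" for z :: "nat \<Rightarrow> 'a"
    unfolding y_def using assms
    by (simp add: cross_cap_def Let_def target_vector_simps del: One_nat_def)
  have y: "r \<noteq> y" if "r \<in> {1..k - 2}" for r
    using assms that by (auto simp: y_def)
  \<comment> \<open>One formula for all columns: off the y-column, a sum of Kronecker deltas that
    gives a power of y at u-positions and 0 at v-positions.\<close>
  have *: "((\<lambda>t. cross_cap k (x(l := t)) y) has_field_derivative
      (if l = y then \<Sum>r=1..k. coord_U k x r * (of_nat r * x y ^ (r - 1))
       else \<Sum>r=1..k - 2. if r = l then x y ^ r else 0)) (at (x l))" for l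
  proof (cases "l = y")
    case True
    have "(\<Sum>r=1..k - 2. (x(y := t)) r * t ^ r) = (\<Sum>r=1..k - 2. x r * t ^ r)" for t
      using y by (intro sum.cong) auto
    then have "cross_cap k (x(y := t)) y = t ^ k + (\<Sum>r=1..k - 2. x r * t ^ r)" for t
      by (simp add: eq)
    then show ?thesis
      unfolding True sum_coord_U[OF assms]
      by (auto intro!: derivative_eq_intros sum.cong simp: mult_ac)
  next
    case False
    \<comment> \<open>Moving the update into an \<open>if\<close> on the index makes each summand
      either linear or constant in \<open>t\<close>.\<close>
    have "(\<Sum>r=1..k - 2. (x(l := t)) r * x y ^ r) =
        (\<Sum>r=1..k - 2. (if r = l then t else x r) * x y ^ r)" for t
      by (intro sum.cong) auto
    then have cap: "cross_cap k (x(l := t)) y =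
        x y ^ k + (\<Sum>r=1..k - 2. (if r = l then t else x r) * x y ^ r)" for t
      using False by (simp add: eq)
    have *: "((\<lambda>t. (if r = l then t else x r) * x y ^ r) has_field_derivative
        (if r = l then x y ^ r else 0)) (at (x l))" for r
      by (auto intro!: derivative_eq_intros)
    have "((\<lambda>t. x y ^ k + (\<Sum>r=1..k - 2. (if r = l then t else x r) * x y ^ r))
        has_field_derivative (\<Sum>r=1..k - 2. if r = l then x y ^ r else 0)) (at (x l))"
      using DERIV_add[OF DERIV_const DERIV_sum[of "{1..k - 2}", OF *]]
      by (simp only: add_0_left)
    then show ?thesis using False by (simp only: cap if_False)
  qed
  have J: "jacobian_matrix (cross_cap k) x y l =
      (if l = y then \<Sum>r=1..k. coord_U k x r * (of_nat r * x y ^ (r - 1))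
       else \<Sum>r=1..k - 2. if r = l then x y ^ r else 0)" for l
    unfolding jacobian_matrix_def partial_deriv_def by (rule DERIV_imp_deriv[OF *])
  show "jacobian_matrix (cross_cap k) x (2 * k - 2) i = x (2 * k - 2) ^ i"
    if "i \<in> {1..k - 2}"
    using J[of i] y[OF that] that by (auto simp: y_def)
  show "jacobian_matrix (cross_cap k) x (2 * k - 2) (k - 2 + i) = 0" if "i \<in> {1..k - 1}"
    using J[of "k - 2 + i"] that assms by (auto simp: y_def intro!: sum.neutral)
  show "jacobian_matrix (cross_cap k) x (2 * k - 2) (2 * k - 2) =
      (\<Sum>r=1..k. coord_U k x r * (of_nat r * x (2 * k - 2) ^ (r - 1)))"
    using J[of y] by (simp add: y_def)
qed

lemma jacobian_matrix_cross_cap_W2: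
  assumes "k \<ge> 2"
  shows "i \<in> {1..k - 2} \<Longrightarrow> jacobian_matrix (cross_cap k) x (2 * k - 1) i = 0"
    and "i \<in> {1..k - 1} \<Longrightarrow>
      jacobian_matrix (cross_cap k) x (2 * k - 1) (k - 2 + i) = x (2 * k - 2) ^ i"
    and "jacobian_matrix (cross_cap k) x (2 * k - 1) (2 * k - 2) =
      (\<Sum>r=1..k - 1. coord_V k x r * (of_nat r * x (2 * k - 2) ^ (r - 1)))"
proof -
  define y where "y = 2 * k - 2"
  have eq: "cross_cap k z (2 * k - 1) = (\<Sum>r=1..k - 1. z (k - 2 + r) * z y ^ r)"
    for z :: "nat \<Rightarrow> 'a"
    unfolding y_def using assms
    by (simp add: cross_cap_def Let_def target_vector_simps del: One_nat_def)
  have y: "k - 2 + r \<noteq> y" if "r \<in> {1..k - 1}" for r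
    using assms that by (auto simp: y_def)
  \<comment> \<open>The same scheme, with the deltas shifted by \<open>k - 2\<close> because the
    v-coordinates start after the u-coordinates.\<close>
  have *: "((\<lambda>t. cross_cap k (x(l := t)) (2 * k - 1)) has_field_derivative
      (if l = y then \<Sum>r=1..k - 1. coord_V k x r * (of_nat r * x y ^ (r - 1))
       else \<Sum>r=1..k - 1. if k - 2 + r = l then x y ^ r else 0)) (at (x l))" for l
  proof (cases "l = y")
    case True
    have "(\<Sum>r=1..k - 1. (x(y := t)) (k - 2 + r) * t ^ r) =
        (\<Sum>r=1..k - 1. coord_V k x r * t ^ r)" for t
      using y by (intro sum.cong) (auto simp: coord_V_def)
    then have "cross_cap k (x(y := t)) (2 * k - 1) = (\<Sum>r=1..k - 1. coord_V k x r * t ^ r)" for t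
      by (simp only: eq fun_upd_same)
    then show ?thesis
      unfolding True by (auto intro!: derivative_eq_intros sum.cong simp: mult_ac)
  next
    case False
    have "(\<Sum>r=1..k - 1. (x(l := t)) (k - 2 + r) * x y ^ r) =
        (\<Sum>r=1..k - 1. (if k - 2 + r = l then t else x (k - 2 + r)) * x y ^ r)" for t
      by (intro sum.cong) auto
    then have cap: "cross_cap k (x(l := t)) (2 * k - 1) =
        (\<Sum>r=1..k - 1. (if k - 2 + r = l then t else x (k - 2 + r)) * x y ^ r)" for t
      using False by (simp only: eq fun_upd_other[OF False[symmetric]])
    have *: "((\<lambda>t. (if k - 2 + r = l then t else x (k - 2 + r)) * x y ^ r)
        has_field_derivative (if k - 2 + r = l then x y ^ r else 0)) (at (x l))" for r
      by (auto intro!: derivative_eq_intros)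
    have "((\<lambda>t. \<Sum>r=1..k - 1. (if k - 2 + r = l then t else x (k - 2 + r)) * x y ^ r)
        has_field_derivative (\<Sum>r=1..k - 1. if k - 2 + r = l then x y ^ r else 0)) (at (x l))"
      by (rule DERIV_sum[OF *])
    then show ?thesis using False by (simp only: cap if_False)
  qed
  have J: "jacobian_matrix (cross_cap k) x (2 * k - 1) l =
      (if l = y then \<Sum>r=1..k - 1. coord_V k x r * (of_nat r * x y ^ (r - 1))
       else \<Sum>r=1..k - 1. if k - 2 + r = l then x y ^ r else 0)" for l
    unfolding jacobian_matrix_def partial_deriv_def by (rule DERIV_imp_deriv[OF *])
  show "jacobian_matrix (cross_cap k) x (2 * k - 1) i = 0" if "i \<in> {1..k - 2}"
    using J[of i] that assms by (auto simp: y_def intro!: sum.neutral)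
  show "jacobian_matrix (cross_cap k) x (2 * k - 1) (k - 2 + i) = x (2 * k - 2) ^ i"
    if "i \<in> {1..k - 1}"
    using J[of "k - 2 + i"] y[OF that] that by (auto simp: y_def)
  show "jacobian_matrix (cross_cap k) x (2 * k - 1) (2 * k - 2) =
      (\<Sum>r=1..k - 1. coord_V k x r * (of_nat r * x (2 * k - 2) ^ (r - 1)))"
    using J[of y] by (simp add: y_def)
qed


section \<open>The lifting equations\<close>

text \<open>The operator y d/dy multiplies \<open>y ^ r\<close> by \<open>r\<close>. Sums start at
  1, so the truncated exponent \<open>r - 1\<close> is the true one.\<close>

lemma euler_sum:
  fixes a :: "nat \<Rightarrow> 'a::comm_ring_1"
  shows "(\<Sum>r=1..n. a r * (of_nat r * y ^ (r - 1))) * y = (\<Sum>r=1..n. of_nat r * a r * y ^ r)"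
  unfolding sum_distrib_right
proof (rule sum.cong)
  fix r assume "r \<in> {1..n}"
  then have "y ^ r = y ^ (r - 1) * y"
    by (metis power_minus_mult atLeastAtMost_iff less_eq_Suc_le One_nat_def)
  then show "a r * (of_nat r * y ^ (r - 1)) * y = of_nat r * a r * y ^ r"
    by (simp add: mult_ac)
qed simp

text \<open>At each power \<open>y ^ i\<close>, the factor \<open>k - i\<close> from the
  u-components and \<open>i\<close> from the y-component add up to \<open>k\<close>. In the
  application \<open>b\<close> is \<open>k - j\<close> and \<open>a\<close> is
  \<open>U j\<close>.\<close>

lemma lifting_equation_W1:
  fixes U :: "nat \<Rightarrow> 'a::comm_ring_1"
  assumes "k \<ge> 2" "U (k - 1) = 0"
  shows "(\<Sum>i=1..k - 2. y ^ i * (of_nat (k - i) * b * U i * a)) +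
      (\<Sum>r=1..k. U r * (of_nat r * y ^ (r - 1))) * (b * a * y) =
    of_nat k * b * a * (\<Sum>r=1..k. U r * y ^ r)"
proof -
  obtain m where k: "k = Suc (Suc m)" using assms by (metis le_Suc_ex add_2_eq_Suc)
  \<comment> \<open>The two added terms vanish: \<open>i = k - 1\<close> by the dummy value of
    \<open>U\<close>, and \<open>i = k\<close> by the factor \<open>k - i\<close>.\<close>
  have "(\<Sum>i=1..k - 2. y ^ i * (of_nat (k - i) * b * U i * a)) =
      (\<Sum>i=1..k. b * a * (of_nat (k - i) * U i * y ^ i))"
    using assms(2) unfolding k by (simp add: mult_ac)
  moreover have "(\<Sum>r=1..k. U r * (of_nat r * y ^ (r - 1))) * (b * a * y) =
      (\<Sum>r=1..k. b * a * (of_nat r * U r * y ^ r))"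
    unfolding sum_distrib_left[symmetric] euler_sum[symmetric] by (simp add: mult_ac)
  moreover have "b * a * (of_nat (k - i) * U i * y ^ i) + b * a * (of_nat i * U i * y ^ i) =
      of_nat k * b * a * (U i * y ^ i)" if "i \<in> {1..k}" for i
    using that by (simp add: of_nat_diff algebra_simps)
  ultimately show ?thesis
    by (simp add: sum.distrib[symmetric] sum_distrib_left)
qed

text \<open>Each sum runs over monomials \<open>g (r, s)\<close> in a region of the rectangle
  \<open>Q\<close>. The products with the two cross cap polynomials give \<open>j \<le> s\<close>
  and \<open>j < r\<close>; the inner sums are their parts with \<open>r + s < k + j\<close>, and
  the parts beyond coincide.\<close>

lemma monomial_cancellation:
  fixes U V :: "nat \<Rightarrow> 'a::comm_ring_1"
  assumes U: "\<And>r. r > k \<Longrightarrow> U r = 0" and V: "\<And>s. s \<ge> k \<Longrightarrow> V s = 0"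
    and j: "1 \<le> j" "j \<le> k - 1"
  shows "(\<Sum>i=1..k - 1. y ^ i * ((\<Sum>r=1..<i. U (i + j - r) * V r)
      - (\<Sum>r=1..i. U r * V (i + j - r))
      + V (i + j) * (\<Sum>r=1..k. U r * y ^ r) - U (i + j) * (\<Sum>r=1..k - 1. V r * y ^ r))) =
    - (V j * (\<Sum>r=1..k. U r * y ^ r))"
proof -
  define g where "g = (\<lambda>(r, s). U r * V s * y ^ (r + s - j))"
  define Q where "Q = {1..k} \<times> {1..k - 1}"
  define W1 where "W1 = (\<Sum>r=1..k. U r * y ^ r)"
  define W2 where "W2 = (\<Sum>r=1..k - 1. V r * y ^ r)"
  have fin: "finite Q" by (simp add: Q_def)
  have S1: "V j * W1 + (\<Sum>i=1..k - 1. y ^ i * (V (i + j) * W1)) =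
      sum g {(r, s). (r, s) \<in> Q \<and> j \<le> s}"
  proof -
    \<comment> \<open>The right-hand side of the claim is, up to sign, the missing term
      \<open>i = 0\<close>; including it makes the condition on \<open>s = i + j\<close>
      non-strict.\<close>
    have "V j * W1 + (\<Sum>i=1..k - 1. y ^ i * (V (i + j) * W1)) =
        (\<Sum>i=0..k - 1. y ^ i * (V (i + j) * W1))"
      by (simp add: sum.atLeast_Suc_atMost)
    also have "\<dots> = (\<Sum>(i, r)\<in>{0..k - 1} \<times> {1..k}. y ^ i * (V (i + j) * (U r * y ^ r)))"
      by (simp add: W1_def sum_distrib_left sum.cartesian_product)
    also have "\<dots> = sum g {(r, s). (r, s) \<in> Q \<and> j \<le> s}"
    proof (rule sum.reindex_bij_witness_not_neutral[where
            i = "\<lambda>(r, s). (s - j, r)" and j = "\<lambda>(i, r). (r, i + j)" and T' = "{}"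
            and S' = "{(i, r) \<in> {0..k - 1} \<times> {1..k}. k \<le> i + j}"])
      show "finite {(i, r) \<in> {0..k - 1} \<times> {1..k}. k \<le> i + j}"
        by (rule finite_subset[of _ "{0..k - 1} \<times> {1..k}"]) auto
    qed (use j in \<open>auto simp: Q_def g_def V power_add mult_ac\<close>)
    finally show ?thesis .
  qed
  have S2: "(\<Sum>i=1..k - 1. y ^ i * (U (i + j) * W2)) = sum g {(r, s). (r, s) \<in> Q \<and> j < r}"
  proof -
    have "(\<Sum>i=1..k - 1. y ^ i * (U (i + j) * W2)) =
        (\<Sum>(i, s)\<in>{1..k - 1} \<times> {1..k - 1}. y ^ i * (U (i + j) * (V s * y ^ s)))"
      by (simp add: W2_def sum_distrib_left sum.cartesian_product)
    also have "\<dots> = sum g {(r, s). (r, s) \<in> Q \<and> j < r}"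
    \<comment> \<open>Substitution \<open>r = i + j\<close>; as \<open>i\<close> starts at 1, the
      condition is the strict \<open>j < r\<close>. The exceptional set has \<open>r > k\<close>,
      where \<open>U\<close> vanishes.\<close>
    proof (rule sum.reindex_bij_witness_not_neutral[where
            i = "\<lambda>(r, s). (r - j, s)" and j = "\<lambda>(i, s). (i + j, s)" and T' = "{}"
            and S' = "{(i, s) \<in> {1..k - 1} \<times> {1..k - 1}. k < i + j}"])
      show "finite {(i, s) \<in> {1..k - 1} \<times> {1..k - 1}. k < i + j}"
        by (rule finite_subset[of _ "{1..k - 1} \<times> {1..k - 1}"]) auto
    qed (use j in \<open>auto simp: Q_def g_def U power_add mult_ac\<close>)
    finally show ?thesis .
  qed
  have S3: "(\<Sum>i=1..k - 1. y ^ i * (\<Sum>r=1..<i. U (i + j - r) * V r)) =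
      sum g {(r, s). (r, s) \<in> Q \<and> j < r \<and> r + s < k + j}"
  proof -
    have "(\<Sum>i=1..k - 1. y ^ i * (\<Sum>r=1..<i. U (i + j - r) * V r)) =
        (\<Sum>(i, s)\<in>(SIGMA i:{1..k - 1}. {1..<i}). y ^ i * (U (i + j - s) * V s))"
      by (simp add: sum_distrib_left sum.Sigma)
    also have "\<dots> = sum g {(r, s). (r, s) \<in> Q \<and> j < r \<and> r + s < k + j}"
    \<comment> \<open>Substitution \<open>r = i + j - s\<close>: \<open>s < i\<close> becomes
      \<open>j < r\<close>, and \<open>i \<le> k - 1\<close> becomes
      \<open>r + s < k + j\<close>.\<close>
    proof (rule sum.reindex_bij_witness_not_neutral[where
            i = "\<lambda>(r, s). (r + s - j, s)" and j = "\<lambda>(i, s). (i + j - s, s)" and T' = "{}"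
            and S' = "{(i, s) \<in> (SIGMA i:{1..k - 1}. {1..<i}). k < i + j - s}"])
      show "finite {(i, s) \<in> (SIGMA i:{1..k - 1}. {1..<i}). k < i + j - s}"
        by (rule finite_subset[of _ "SIGMA i:{1..k - 1}. {1..<i}"]) auto
    qed (use j in \<open>auto simp: Q_def g_def U mult_ac\<close>)
    finally show ?thesis .
  qed
  have S4: "(\<Sum>i=1..k - 1. y ^ i * (\<Sum>r=1..i. U r * V (i + j - r))) =
      sum g {(r, s). (r, s) \<in> Q \<and> j \<le> s \<and> r + s < k + j}"
  proof -
    have "(\<Sum>i=1..k - 1. y ^ i * (\<Sum>r=1..i. U r * V (i + j - r))) =
        (\<Sum>(i, r)\<in>(SIGMA i:{1..k - 1}. {1..i}). y ^ i * (U r * V (i + j - r)))"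
      by (simp add: sum_distrib_left sum.Sigma)
    also have "\<dots> = sum g {(r, s). (r, s) \<in> Q \<and> j \<le> s \<and> r + s < k + j}"
    \<comment> \<open>Substitution \<open>s = i + j - r\<close>: \<open>r \<le> i\<close> becomes
      \<open>j \<le> s\<close>. The exceptional set has \<open>s \<ge> k\<close>, where
      \<open>V\<close> vanishes.\<close>
    proof (rule sum.reindex_bij_witness_not_neutral[where
            i = "\<lambda>(r, s). (r + s - j, r)" and j = "\<lambda>(i, r). (r, i + j - r)" and T' = "{}"
            and S' = "{(i, r) \<in> (SIGMA i:{1..k - 1}. {1..i}). k \<le> i + j - r}"])
      show "finite {(i, r) \<in> (SIGMA i:{1..k - 1}. {1..i}). k \<le> i + j - r}"
        by (rule finite_subset[of _ "SIGMA i:{1..k - 1}. {1..i}"]) auto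
    qed (use j in \<open>auto simp: Q_def g_def V mult_ac\<close>)
    finally show ?thesis .
  qed
  have split: "sum g {(r, s). (r, s) \<in> Q \<and> P r s} =
      sum g {(r, s). (r, s) \<in> Q \<and> P r s \<and> r + s < k + j} +
      sum g {(r, s). (r, s) \<in> Q \<and> P r s \<and> k + j \<le> r + s}" for P
    by (subst sum.union_disjoint[symmetric])
      (auto intro!: finite_subset[OF _ fin] sum.cong)
  text \<open>Since \<open>r \<le> k\<close> and \<open>s < k\<close>, a term with \<open>r + s \<ge> k + j\<close> has both \<open>s \<ge> j\<close> and \<open>r > j\<close>.\<close>
  have "{(r, s). (r, s) \<in> Q \<and> j \<le> s \<and> k + j \<le> r + s} =
      {(r, s). (r, s) \<in> Q \<and> j < r \<and> k + j \<le> r + s}"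
    using j by (auto simp: Q_def)
  then have "V j * W1 + (\<Sum>i=1..k - 1. y ^ i * (V (i + j) * W1))
        - (\<Sum>i=1..k - 1. y ^ i * (U (i + j) * W2)) =
      (\<Sum>i=1..k - 1. y ^ i * (\<Sum>r=1..i. U r * V (i + j - r)))
        - (\<Sum>i=1..k - 1. y ^ i * (\<Sum>r=1..<i. U (i + j - r) * V r))"
    unfolding S1 S2 S3 S4 using split[of "\<lambda>r s. j \<le> s"] split[of "\<lambda>r s. j < r"] by simp
  \<comment> \<open>\<open>a\<close>, \<open>b\<close>, \<open>c\<close>, \<open>d\<close> are the
    four sums in the order of the claim, and \<open>p\<close> is \<open>V j * W1\<close>.\<close>
  moreover have "a - b + c - d = - p" if "p + c - d = b - a" for a b c d p :: 'a
  proof -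
    have "a - b + c - d = (p + c - d) - (b - a) - p" by simp
    then show ?thesis unfolding that by simp
  qed
  ultimately show ?thesis
    unfolding W1_def[symmetric] W2_def[symmetric]
    by (simp only: distrib_left right_diff_distrib sum.distrib sum_subtractf)
qed

text \<open>The factor \<open>-(i - 1)\<close> of the v-components and \<open>i\<close> from the
  y-component leave 1, which yields the term in \<open>W2\<close>. All else is \<open>k\<close>
  times \<open>monomial_cancellation\<close>.\<close>

lemma lifting_equation_W2:
  fixes U V :: "nat \<Rightarrow> 'a::comm_ring_1"
  assumes U: "\<And>r. r > k \<Longrightarrow> U r = 0" and V: "\<And>s. s \<ge> k \<Longrightarrow> V s = 0"
    and j: "1 \<le> j" "j \<le> k - 1"
    and W1: "W1 = (\<Sum>r=1..k. U r * y ^ r)" and W2: "W2 = (\<Sum>r=1..k - 1. V r * y ^ r)"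
  shows "(\<Sum>i=1..k - 1. y ^ i * (of_nat k * (\<Sum>r=1..<i. U (i + j - r) * V r)
        - of_nat k * (\<Sum>r=1..i. U r * V (i + j - r))
        - of_nat (i - 1) * b * a * V i
        + of_nat k * V (i + j) * W1 - of_nat k * U (i + j) * W2)) +
      (\<Sum>r=1..k - 1. V r * (of_nat r * y ^ (r - 1))) * (b * a * y) =
    - of_nat k * V j * W1 + b * a * W2"
proof -
  define T where "T i = (\<Sum>r=1..<i. U (i + j - r) * V r) - (\<Sum>r=1..i. U r * V (i + j - r))
      + V (i + j) * W1 - U (i + j) * W2" for i
  have euler: "(\<Sum>r=1..k - 1. V r * (of_nat r * y ^ (r - 1))) * (b * a * y) =
      (\<Sum>i=1..k - 1. b * a * (of_nat i * V i * y ^ i))"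
    unfolding sum_distrib_left[symmetric] euler_sum[symmetric] by (simp add: mult_ac)
  have "(\<Sum>i=1..k - 1. y ^ i * (of_nat k * (\<Sum>r=1..<i. U (i + j - r) * V r)
        - of_nat k * (\<Sum>r=1..i. U r * V (i + j - r))
        - of_nat (i - 1) * b * a * V i
        + of_nat k * V (i + j) * W1 - of_nat k * U (i + j) * W2)) +
      (\<Sum>i=1..k - 1. b * a * (of_nat i * V i * y ^ i)) =
    (\<Sum>i=1..k - 1. of_nat k * (y ^ i * T i) + b * a * (V i * y ^ i))"
    unfolding sum.distrib[symmetric]
    by (rule sum.cong) (simp_all add: T_def of_nat_diff algebra_simps)
  also have "\<dots> = of_nat k * (\<Sum>i=1..k - 1. y ^ i * T i) + b * a * W2"
    by (simp add: W2 sum.distrib sum_distrib_left)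
  also have "(\<Sum>i=1..k - 1. y ^ i * T i) = - (V j * W1)"
    unfolding T_def W1 W2 by (rule monomial_cancellation[OF U V j])
  finally show ?thesis unfolding euler by (simp add: mult.assoc)
qed

section \<open>Construction and verification of the lift\<close>

lemma liftable_xi1:
  assumes k: "k \<ge> 2" and j: "1 \<le> j" "j \<le> k - 1"
  shows "liftable c (2 * k - 2) (2 * k - 1)
    (cross_cap k :: (nat \<Rightarrow> 'a::real_normed_field) \<Rightarrow> (nat \<Rightarrow> 'a)) (xi1 k j)"
proof -
  define n where "n = 2 * k - 2"
  \<comment> \<open>Position \<open>n\<close> carries the \<open>W1\<close>-component in the target
    but the y-component in the source, so it is overwritten; clearing \<open>Suc n\<close> puts the
    values in \<open>kspace n\<close>.\<close>
  define \<eta> :: "(nat \<Rightarrow> 'a) \<Rightarrow> nat \<Rightarrow> 'a" where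
    "\<eta> x = (xi1 k j (cross_cap k x))
       (n := of_nat (k - j) * coord_U k x j * x n, Suc n := 0)" for x
  have n: "2 * k - 1 = Suc n" "n > 0" "k - 2 < n" using k by (auto simp: n_def)
  have xi1_space: "xi1 k j X \<in> kspace (Suc n)" for X :: "nat \<Rightarrow> 'a"
    unfolding xi1_def Let_def n(1)[symmetric] by (rule target_vector_in_kspace[OF k])
  have "map_germ c n (Suc n) (cross_cap k :: (nat \<Rightarrow> 'a) \<Rightarrow> (nat \<Rightarrow> 'a))"
    unfolding map_germ_def
  proof (intro conjI ballI always_eventually allI)
    show "cross_cap k x \<in> kspace (Suc n)" for x :: "nat \<Rightarrow> 'a"
      unfolding cross_cap_def Let_def n(1)[symmetric] by (rule target_vector_in_kspace[OF k])
    show "cross_cap k (\<lambda>_. 0) = (\<lambda>_. 0 :: 'a)"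
      using k by (auto simp: cross_cap_def Let_def target_vector_def fun_eq_iff)
    show "function_germ c n (\<lambda>x :: nat \<Rightarrow> 'a. cross_cap k x i)" for i
      unfolding n_def by (intro polynomial_map_function_germ polynomial_map_cross_cap k)
  qed
  moreover have "vector_field_germ c (Suc n) (xi1 k j :: (nat \<Rightarrow> 'a) \<Rightarrow> (nat \<Rightarrow> 'a))"
    unfolding vector_field_germ_def using xi1_space polynomial_map_xi1[OF k, unfolded n(1)]
    by (auto intro!: always_eventually polynomial_map_function_germ)
  moreover have "vector_field_germ c n \<eta>"
    unfolding vector_field_germ_def
  proof (intro conjI ballI always_eventually allI)
    show "\<eta> x \<in> kspace n" for x
      using xi1_space[of "cross_cap k x"] n by (auto simp: \<eta>_def kspace_def le_Suc_eq)
    have "polynomial_map n (\<lambda>x :: nat \<Rightarrow> 'a. xi1 k j (cross_cap k x) i)" for i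
      unfolding n_def
      by (rule polynomial_map_compose[OF polynomial_map_xi1[OF k] polynomial_map_cross_cap[OF k]])
    moreover have "polynomial_map n (\<lambda>x :: nat \<Rightarrow> 'a. of_nat (k - j) * coord_U k x j * x n)"
      using n by (auto intro!: polynomial_map_intros polynomial_map_coord_U simp: n_def)
    ultimately show "function_germ c n (\<lambda>x. \<eta> x i)" for i
      unfolding \<eta>_def fun_upd_apply
      by (intro polynomial_map_function_germ polynomial_map_if polynomial_map.const)
  qed
  moreover have "(\<Sum>l=1..n. jacobian_matrix (cross_cap k) x i l * \<eta> x l) =
      xi1 k j (cross_cap k x) i" if i: "i \<in> {1..Suc n}" for x i
  proof -
    define U V where "U = coord_U k x" and "V = coord_V k x"
    define W1 W2 where "W1 = (\<Sum>r=1..k. U r * x n ^ r)" and "W2 = (\<Sum>r=1..k - 1. V r * x n ^ r)"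
    have cap: "cross_cap k x n = W1" "cross_cap k x (Suc n) = W2"
    proof -
      show "cross_cap k x n = W1"
        using k by (simp add: cross_cap_def Let_def target_vector_simps n_def
            W1_def U_def sum_coord_U del: One_nat_def)
      have "cross_cap k x (2 * k - 1) = (\<Sum>i=1..k - 1. x (k - 2 + i) * x n ^ i)"
        using k by (simp add: cross_cap_def Let_def target_vector_simps n_def del: One_nat_def)
      also have "\<dots> = W2"
        unfolding W2_def V_def by (intro sum.cong) (auto simp: coord_V_def)
      finally show "cross_cap k x (Suc n) = W2" by (simp only: n)
    qed
    \<comment> \<open>The field along the cross cap, expressed in the source point: \<open>U\<close>
      and \<open>V\<close> are read off \<open>x\<close>, and \<open>W1\<close>, \<open>W2\<close>
      are polynomials in its last coordinate.\<close>
    note xi = xi1_def[of k j "cross_cap k x", unfolded Let_def coord_cross_cap[OF k] n(1)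
        n_def[symmetric] cap, folded U_def V_def]
    have eta: "\<eta> x i = xi1 k j (cross_cap k x) i" if "i < n" for i
      using that by (simp add: \<eta>_def)
    have eta_u: "\<eta> x i = of_nat (k - i) * of_nat (k - j) * U i * U j" if i: "i \<in> {1..k - 2}" for i
    proof -
      have "i < n" using i n by auto
      show ?thesis unfolding eta[OF \<open>i < n\<close>] xi by (rule target_vector_simps(1)[OF k i])
    qed
    have eta_v: "\<eta> x (k - 2 + i) = of_nat k * (\<Sum>r=1..<i. U (i + j - r) * V r)
        - of_nat k * (\<Sum>r=1..i. U r * V (i + j - r))
        - of_nat (i - 1) * of_nat (k - j) * U j * V i
        + of_nat k * V (i + j) * W1 - of_nat k * U (i + j) * W2" if i: "i \<in> {1..k - 1}" for i
    proof -
      have "k - 2 + i < n" using i k by (auto simp: n_def)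
      show ?thesis unfolding eta[OF \<open>k - 2 + i < n\<close>] xi by (rule target_vector_simps(2)[OF k i])
    qed
    have eta_y: "\<eta> x n = of_nat (k - j) * U j * x n"
      by (simp add: \<eta>_def U_def)
    note split = sum_source_coordinates[OF k, folded n_def]
    consider "i \<in> {1..2 * k - 3}" | "i = n" | "i = Suc n"
      using i by (fastforce simp: n_def)
    then show ?thesis
    proof cases
      \<comment> \<open>An identity row of the Jacobian matrix selects \<open>\<eta> x i\<close>,
        which agrees with the field below position \<open>n\<close>.\<close>
      case 1
      then have "i \<in> {1..n}" by (auto simp: n_def)
      moreover have "\<eta> x i = xi1 k j (cross_cap k x) i"
        using 1 by (auto simp: \<eta>_def n_def)
      ultimately show ?thesis
        by (simp add: jacobian_matrix_cross_cap_coordinate[OF k 1] if_distribR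
            sum.delta if_distrib[of "\<lambda>a. a * _"] cong: if_cong)
    next
      case 2
      have "U (k - 1) = 0" using k by (auto simp: U_def coord_U_def)
      note eq = lifting_equation_W1[where U = U and y = "x n" and b = "of_nat (k - j)" and a = "U j",
          OF k this, folded W1_def]
      note J = jacobian_matrix_cross_cap_W1[OF k, where x = x, folded n_def U_def]
      have "(\<Sum>i=1..k - 2. jacobian_matrix (cross_cap k) x n i * \<eta> x i) =
          (\<Sum>i=1..k - 2. x n ^ i * (of_nat (k - i) * of_nat (k - j) * U i * U j))"
        by (rule sum.cong) (simp_all only: J(1) eta_u)
      moreover have "(\<Sum>i=1..k - 1. jacobian_matrix (cross_cap k) x n (k - 2 + i) *
          \<eta> x (k - 2 + i)) = 0"
        by (rule sum.neutral) (intro ballI, simp only: J(2) mult_zero_left)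
      ultimately have "(\<Sum>l=1..n. jacobian_matrix (cross_cap k) x n l * \<eta> x l) =
          of_nat k * of_nat (k - j) * U j * W1"
        by (simp only: split J(3) eta_y eq add_0_left add_0_right)
      also have "\<dots> = xi1 k j (cross_cap k x) n"
        unfolding xi by (rule target_vector_simps(3)[OF k, folded n_def, symmetric])
      finally show ?thesis unfolding 2 .
    next
      case 3
      have U0: "U r = 0" if "r > k" for r
        using that by (simp add: U_def coord_U_def)
      have V0: "V s = 0" if "s \<ge> k" for s
        using that k by (auto simp: V_def coord_V_def)
      note eq = lifting_equation_W2[where b = "of_nat (k - j)" and a = "U j",
          OF U0 V0 j W1_def W2_def]
      note J = jacobian_matrix_cross_cap_W2[OF k, where x = x, folded n_def V_def, unfolded n(1)]
      have "(\<Sum>i=1..k - 2. jacobian_matrix (cross_cap k) x (Suc n) i * \<eta> x i) = 0"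
        by (rule sum.neutral) (intro ballI, simp only: J(1) mult_zero_left)
      moreover have "(\<Sum>i=1..k - 1. jacobian_matrix (cross_cap k) x (Suc n) (k - 2 + i) *
            \<eta> x (k - 2 + i)) =
          (\<Sum>i=1..k - 1. x n ^ i * (of_nat k * (\<Sum>r=1..<i. U (i + j - r) * V r)
            - of_nat k * (\<Sum>r=1..i. U r * V (i + j - r))
            - of_nat (i - 1) * of_nat (k - j) * U j * V i
            + of_nat k * V (i + j) * W1 - of_nat k * U (i + j) * W2))"
        by (rule sum.cong) (simp_all only: J(2) eta_v)
      ultimately have "(\<Sum>l=1..n. jacobian_matrix (cross_cap k) x (Suc n) l * \<eta> x l) =
          - of_nat k * V j * W1 + of_nat (k - j) * U j * W2"
        by (simp only: split J(3) eta_y eq add_0_left add_0_right)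
      also have "\<dots> = xi1 k j (cross_cap k x) (Suc n)"
        unfolding xi by (rule target_vector_simps(4)[OF k, unfolded n(1), symmetric])
      finally show ?thesis unfolding 3 .
    qed
  qed
  ultimately show ?thesis
    unfolding liftable_def n_def[symmetric] n(1) by (auto intro!: always_eventually)
qed

text \<open>The construction works over any real normed field, so the real and complex cases are
  instances of it.\<close>

theorem theorem3p1:
  fixes k j :: nat and c :: regularity
  assumes "k \<ge> 2" and "1 \<le> j" and "j \<le> k - 1"
  shows "liftable c (2 * k - 2) (2 * k - 1)
           (cross_cap k :: (nat \<Rightarrow> real) \<Rightarrow> (nat \<Rightarrow> real)) (xi1 k j) \<and>
         liftable c (2 * k - 2) (2 * k - 1)
           (cross_cap k :: (nat \<Rightarrow> complex) \<Rightarrow> (nat \<Rightarrow> complex)) (xi1 k j)"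
  by (intro conjI liftable_xi1 assms)

end
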